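(* If $G$ is a graph whose acyclic polynomial $A(G,x)$ has degree three, then $A(G,x)$ is stable.
   Context: Graphs are finite, undirected and simple. The acyclic polynomial of a graph $G$ is $A(G,x)=\sum_{i\ge 0} a_i x^i$, where $a_i=|\{S\subseteq V(G): |S|=i \text{ and } G[S] \text{ is acyclic}\}|$ and $G[S]$ is the subgraph of $G$ induced by $S$ (acyclic means containing no cycle; the empty set is acyclic). A polynomial is stable if all its complex roots lie in the left half-plane $\{z\in\mathbb{C}:\operatorname{Re} z\le 0\}$. *)

theory Defs
  imports
    Complex_Main
    "HOL-Computational_Algebra.Polynomial"
    "Graph_Theory.Digraph_Component"
begin

text \<open>
  Finite simple graphs are the symmetric, loop-free digraphs without parallel arcs of the locale
  \<^locale>\<open>graph\<close>: an edge uv is the pair of opposite arcs (u,v) and (v,u).  Under this encoding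
  the walk u, v, u along a single edge satisfies the library predicate \<^const>\<open>pre_digraph.cycle\<close>.
  The cycles of the undirected graph are precisely the library cycles with at least three arcs,
  which is why the library predicate \<^const>\<open>forest\<close> is not used here.
\<close>

definition acyclic_graph :: "('a, 'b) pre_digraph \<Rightarrow> bool" where
  "acyclic_graph G \<longleftrightarrow> \<not> (\<exists>p. pre_digraph.cycle G p \<and> 3 \<le> length p)"

definition acyclic_count :: "('a, 'b) pre_digraph \<Rightarrow> nat \<Rightarrow> nat" where
  "acyclic_count G i = card {S. S \<subseteq> verts G \<and> card S = i \<and> acyclic_graph (G \<restriction> S)}"

text \<open>The sum may stop at the number of vertices, as the later coefficients vanish.\<close>

definition acyclic_poly :: "('a, 'b) pre_digraph \<Rightarrow> real poly" where
  "acyclic_poly G = (\<Sum>i\<le>card (verts G). monom (of_nat (acyclic_count G i)) i)"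

lemma coeff_acyclic_poly:
  assumes "finite (verts G)"
  shows "coeff (acyclic_poly G) i = of_nat (acyclic_count G i)"
proof (cases "i \<le> card (verts G)")
  case True
  then show ?thesis by (simp add: acyclic_poly_def coeff_sum)
next
  case False
  with assms have "{S. S \<subseteq> verts G \<and> card S = i \<and> acyclic_graph (G \<restriction> S)} = {}"
    by (auto dest: card_mono)
  then have "acyclic_count G i = 0" by (simp only: acyclic_count_def card.empty)
  with False show ?thesis by (simp add: acyclic_poly_def coeff_sum)
qed

definition stable_poly :: "complex poly \<Rightarrow> bool" where
  "stable_poly p \<longleftrightarrow> (\<forall>z. poly p z = 0 \<longrightarrow> Re z \<le> 0)"

end

theory Submission
  imports Defs
begin

text \<open>
  If \<open>A(G,x)\<close> has degree three, then it is \<open>1 + n x + C(n,2) x\<^sup>2 + a\<^sub>3 x\<^sup>3\<close> with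
  \<open>n\<close> the number of vertices, because a cycle needs three vertices and so every smaller set is
  acyclic; moreover \<open>0 < a\<^sub>3 \<le> C(n,3)\<close>.  A real cubic with nonnegative coefficients and
  positive leading coefficient is stable as soon as the product of its two middle coefficients is
  at least the product of its outer ones (the Routh--Hurwitz criterion,
  \<open>cubic_root_Re_nonpos\<close>), and here this reads \<open>a\<^sub>3 \<le> n C(n,2)\<close>, which holds since
  \<open>C(n,3) \<le> n C(n,2)\<close>.
\<close>

text \<open>
  At a root \<open>x + i y\<close> with \<open>x > 0\<close> and \<open>y \<noteq> 0\<close>, the imaginary part determines
  \<open>a\<^sub>3 y\<^sup>2\<close>; eliminating \<open>y\<close> from \<open>a\<^sub>3\<close> times the real part leaves a cubic in
  \<open>x\<close> alone whose coefficients are all nonpositive, the constant one being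
  \<open>a\<^sub>0 a\<^sub>3 - a\<^sub>1 a\<^sub>2\<close> and the leading one \<open>- 8 a\<^sub>3\<^sup>2 < 0\<close>, so it cannot vanish.
\<close>

lemma cubic_root_Re_nonpos:
  fixes a0 a1 a2 a3 :: real and z :: complex
  assumes nonneg: "0 \<le> a0" "0 \<le> a1" "0 \<le> a2" and pos: "0 < a3"
    and hurwitz: "a0 * a3 \<le> a1 * a2"
    and root: "of_real a0 + of_real a1 * z + of_real a2 * z ^ 2 + of_real a3 * z ^ 3 = 0"
  shows "Re z \<le> 0"
proof (rule ccontr)
  assume "\<not> Re z \<le> 0"
  define x y where "x = Re z" and "y = Im z"
  have x: "0 < x" using \<open>\<not> Re z \<le> 0\<close> by (simp add: x_def)
  have re: "a0 + a1 * x + a2 * (x\<^sup>2 - y\<^sup>2) + a3 * (x ^ 3 - 3 * x * y\<^sup>2) = 0"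
    using arg_cong[OF root, of Re]
    by (simp add: x_def y_def power2_eq_square power3_eq_cube algebra_simps)
  have im: "y * (a1 + 2 * a2 * x + a3 * (3 * x\<^sup>2 - y\<^sup>2)) = 0"
    using arg_cong[OF root, of Im]
    by (simp add: x_def y_def power2_eq_square power3_eq_cube algebra_simps)
  show False
  proof (cases "y = 0")
    case True
    have "a0 + a1 * x + a2 * x\<^sup>2 + a3 * x ^ 3 = 0" using re True by simp
    moreover have "0 < a3 * x ^ 3" using pos x by simp
    moreover have "0 \<le> a1 * x" "0 \<le> a2 * x\<^sup>2" using nonneg x by simp_all
    ultimately show False using nonneg(1) by linarith
  next
    case False
    then have "a1 + 2 * a2 * x + a3 * (3 * x\<^sup>2 - y\<^sup>2) = 0" using im by simp
    then have y2: "a3 * y\<^sup>2 = a1 + 2 * a2 * x + 3 * a3 * x\<^sup>2"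
      by (simp add: algebra_simps)
    have "0 = a3 * (a0 + a1 * x + a2 * (x\<^sup>2 - y\<^sup>2) + a3 * (x ^ 3 - 3 * x * y\<^sup>2))"
      using re by simp
    also have "\<dots> = a0 * a3 + a1 * a3 * x + a2 * a3 * x\<^sup>2 + a3\<^sup>2 * x ^ 3
        - (a2 + 3 * a3 * x) * (a3 * y\<^sup>2)"
      by (simp add: algebra_simps power2_eq_square)
    also have "\<dots> = (a0 * a3 - a1 * a2) - 2 * (a1 * a3 + a2\<^sup>2) * x
        - 8 * a2 * a3 * x\<^sup>2 - 8 * a3\<^sup>2 * x ^ 3"
      unfolding y2 by (simp add: algebra_simps power2_eq_square power3_eq_cube)
    finally have "(a0 * a3 - a1 * a2) - 2 * (a1 * a3 + a2\<^sup>2) * x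
        - 8 * a2 * a3 * x\<^sup>2 - 8 * a3\<^sup>2 * x ^ 3 = 0" by simp
    moreover have "0 \<le> 2 * (a1 * a3 + a2\<^sup>2) * x" "0 \<le> 8 * a2 * a3 * x\<^sup>2" "0 < 8 * a3\<^sup>2 * x ^ 3"
      using nonneg pos x by simp_all
    ultimately show False using hurwitz by linarith
  qed
qed

text \<open>
  The vertices visited by a cycle, without the repeated first one, are distinct and as many as its
  arcs, so a cycle with three arcs does not fit on two vertices.
\<close>

lemma (in wf_digraph) acyclic_graph_induce_subgraph_card_le_2:
  assumes "finite S" "card S \<le> 2"
  shows "acyclic_graph (G \<restriction> S)"
  unfolding acyclic_graph_def
proof
  assume "\<exists>p. pre_digraph.cycle (G \<restriction> S) p \<and> 3 \<le> length p"
  then obtain p u where p: "3 \<le> length p"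
    and walk: "pre_digraph.awalk (G \<restriction> S) u p u"
    and dist: "distinct (tl (pre_digraph.awalk_verts (G \<restriction> S) u p))"
    unfolding pre_digraph.cycle_def by blast
  let ?vs = "tl (pre_digraph.awalk_verts (G \<restriction> S) u p)"
  interpret H: wf_digraph "G \<restriction> S"
    by (rule wellformed_induce_subgraph)
  have "set ?vs \<subseteq> S"
    using walk list.set_sel(2)[OF H.awalk_verts_non_Nil] unfolding H.awalk_conv by fastforce
  then have "length ?vs \<le> card S"
    using dist assms(1) by (metis card_mono distinct_card)
  then show False using p assms(2) by (simp add: H.length_awalk_verts)
qed

lemma acyclic_count_le_choose:
  assumes "finite (verts G)"
  shows "acyclic_count G k \<le> card (verts G) choose k"
proof -
  have "acyclic_count G k \<le> card {S. S \<subseteq> verts G \<and> card S = k}"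
    unfolding acyclic_count_def using assms by (intro card_mono) auto
  also have "\<dots> = card (verts G) choose k"
    using assms by (rule n_subsets)
  finally show ?thesis .
qed

lemma (in wf_digraph) acyclic_count_eq_choose:
  assumes "finite (verts G)" "k \<le> 2"
  shows "acyclic_count G k = card (verts G) choose k"
proof -
  have "{S. S \<subseteq> verts G \<and> card S = k \<and> acyclic_graph (G \<restriction> S)} = {S. S \<subseteq> verts G \<and> card S = k}"
    using assms by (auto intro: acyclic_graph_induce_subgraph_card_le_2 finite_subset)
  then show ?thesis
    unfolding acyclic_count_def using n_subsets[OF assms(1)] by simp
qed

lemma choose_3_le: "n choose 3 \<le> n * (n choose 2)"
proof (cases n)
  case (Suc m)
  have "n choose 3 \<le> 3 * (n choose 3)" by simp
  also have "\<dots> = n * (m choose 2)"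
    using Suc_times_binomial[of 2 m] Suc by (simp add: numeral_3_eq_3 numeral_2_eq_2)
  also have "\<dots> \<le> n * (n choose 2)"
    using Suc by (intro mult_le_mono2 binomial_right_mono) simp
  finally show ?thesis .
qed simp

theorem theorem2p8:
  fixes G :: "('a, 'b) pre_digraph"
  assumes "graph G"
    and "degree (acyclic_poly G) = 3"
  shows "stable_poly (map_poly complex_of_real (acyclic_poly G))"
  unfolding stable_poly_def
proof (intro allI impI)
  interpret graph G by fact
  let ?n = "card (verts G)"
  have fin: "finite (verts G)" by simp
  note coeff = coeff_acyclic_poly[OF fin] acyclic_count_eq_choose[OF fin]
  have coeffs: "coeff (acyclic_poly G) 0 = 1" "coeff (acyclic_poly G) 1 = ?n"
    "coeff (acyclic_poly G) 2 = ?n choose 2" "coeff (acyclic_poly G) 3 = acyclic_count G 3"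
    by (simp_all add: coeff)
  have "coeff (acyclic_poly G) 3 \<noteq> 0"
    using assms(2) leading_coeff_0_iff[of "acyclic_poly G"] by auto
  then have pos: "0 < real (acyclic_count G 3)" by (simp add: coeffs)
  have "acyclic_count G 3 \<le> ?n * (?n choose 2)"
    using acyclic_count_le_choose[OF fin] choose_3_le by (rule order_trans)
  then have hurwitz: "1 * real (acyclic_count G 3) \<le> real ?n * real (?n choose 2)"
    unfolding mult_1 of_nat_mult[symmetric] of_nat_le_iff .
  fix z :: complex
  assume "poly (map_poly complex_of_real (acyclic_poly G)) z = 0"
  then have "(\<Sum>i\<le>3. of_real (coeff (acyclic_poly G) i) * z ^ i) = 0"
    by (simp add: poly_altdef degree_map_poly coeff_map_poly assms(2))
  then have "of_real 1 + of_real (real ?n) * z + of_real (real (?n choose 2)) * z ^ 2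
      + of_real (real (acyclic_count G 3)) * z ^ 3 = 0"
    using coeffs by (simp add: numeral_3_eq_3 numeral_2_eq_2)
  from cubic_root_Re_nonpos[OF _ _ _ pos hurwitz this] show "Re z \<le> 0" by simp
qed

end
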